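(* Let $\theta_1,\theta_2>0$ and let $H:\mathbb{R}_+^2\to\mathbb{R}_+^2$ be $$H(x_1,x_2)=\Big(\tfrac{\theta_1x_1}{2}(x_1+2x_2),\ \tfrac{\theta_2x_2}{2}(x_2+2x_1)\Big).$$ Let $E_1=(\tfrac{2}{\theta_1},0)$, $E_2=(0,\tfrac{2}{\theta_2})$ and $\overline{E}=\big(\tfrac{4\theta_1-2\theta_2}{3\theta_1\theta_2},\tfrac{4\theta_2-2\theta_1}{3\theta_1\theta_2}\big)$. Let $(x_1^0,x_2^0)\in\mathbb{R}_+^2$ denote an arbitrary initial point that is not a fixed point of $H$. (a) If $\theta_1<2\theta_2$ and $\theta_2<2\theta_1$, then there is an invariant curve $x_2=\gamma(x_1)$, $0\le x_1\le \tfrac{2}{\theta_1}$, passing through $E_1$, $E_2$ and $\overline{E}$, such that $$\lim_{m\to\infty}H^m(x_1^0,x_2^0)=\begin{cases}(0,0), & \text{if } 0\le x_1^0<\tfrac{2}{\theta_1},\ 0\le x_2^0<\gamma(x_1^0),\\ \overline{E}, & \text{if } 0<x_1^0<\tfrac{2}{\theta_1},\ x_2^0=\gamma(x_1^0),\\ \infty, & \text{if } (x_1^0,x_2^0) \text{ lies above the curve.}\end{cases}$$ (b) If $\theta_1>2\theta_2$, then there is an invariant curve $x_2=\sigma(x_1)$, $0\le x_1\le\tfrac{2}{\theta_1}$, passing through $E_1$ and $E_2$, such that $$\lim_{m\to\infty}H^m(x_1^0,x_2^0)=\begin{cases}(0,0), & \text{if } 0\le x_1^0<\tfrac{2}{\theta_1},\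 0\le x_2^0<\sigma(x_1^0),\\ E_1, & \text{if } 0<x_1^0<\tfrac{2}{\theta_1},\ x_2^0=\sigma(x_1^0),\\ \infty, & \text{if } (x_1^0,x_2^0) \text{ lies above the curve.}\end{cases}$$ (c) If $\theta_2>2\theta_1$, then there is an invariant curve $x_2=\delta(x_1)$, $0\le x_1\le\tfrac{2}{\theta_1}$, passing through $E_1$ and $E_2$, such that $$\lim_{m\to\infty}H^m(x_1^0,x_2^0)=\begin{cases}(0,0), & \text{if } 0\le x_1^0<\tfrac{2}{\theta_1},\ 0\le x_2^0<\delta(x_1^0),\\ E_2, & \text{if } 0<x_1^0<\tfrac{2}{\theta_1},\ x_2^0=\delta(x_1^0),\\ \infty, & \text{if } (x_1^0,x_2^0) \text{ lies above the curve.}\end{cases}$$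
   Context: $\mathbb{R}_+^2=\{(x_1,x_2): x_1\ge0,\ x_2\ge0\}$; $H^m$ is the $m$-th iterate of $H$. A curve $x_2=g(x_1)$, $0\le x_1\le 2/\theta_1$, means the graph $\Gamma\subset\mathbb{R}_+^2$ of a continuous function $g:[0,2/\theta_1]\to[0,\infty)$; it is invariant if $H(\Gamma)\subseteq\Gamma$. A point $(x_1^0,x_2^0)\in\mathbb{R}_+^2$ lies above the curve if either $0\le x_1^0\le 2/\theta_1$ and $x_2^0>g(x_1^0)$, or $x_1^0>2/\theta_1$. The limit being $\infty$ means $\|H^m(x_1^0,x_2^0)\|\to\infty$. *)

theory Defs
  imports "HOL-Analysis.Analysis"
begin

definition quadrant :: "(real \<times> real) set" where
  "quadrant = {(x1, x2). 0 \<le> x1 \<and> 0 \<le> x2}"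

text \<open>The map is a total function on the plane; it is only ever applied to points of
  the closed quadrant, which it preserves.\<close>

definition H :: "real \<Rightarrow> real \<Rightarrow> real \<times> real \<Rightarrow> real \<times> real" where
  "H \<theta>1 \<theta>2 = (\<lambda>(x1, x2). (\<theta>1 * x1 / 2 * (x1 + 2 * x2), \<theta>2 * x2 / 2 * (x2 + 2 * x1)))"

lemma H_quadrant:
  assumes "0 < \<theta>1" "0 < \<theta>2"
  shows "H \<theta>1 \<theta>2 \<in> quadrant \<rightarrow> quadrant"
  using assms by (auto simp: H_def quadrant_def)

definition E1 :: "real \<Rightarrow> real \<times> real" where
  "E1 \<theta>1 = (2 / \<theta>1, 0)"

definition E2 :: "real \<Rightarrow> real \<times> real" where
  "E2 \<theta>2 = (0, 2 / \<theta>2)"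

definition Ebar :: "real \<Rightarrow> real \<Rightarrow> real \<times> real" where
  "Ebar \<theta>1 \<theta>2 =
    ((4 * \<theta>1 - 2 * \<theta>2) / (3 * \<theta>1 * \<theta>2), (4 * \<theta>2 - 2 * \<theta>1) / (3 * \<theta>1 * \<theta>2))"

definition curve :: "real \<Rightarrow> (real \<Rightarrow> real) \<Rightarrow> (real \<times> real) set" where
  "curve a g = (\<lambda>x. (x, g x)) ` {0..a}"

text \<open>The values of \<open>g\<close> outside \<open>[0, a]\<close> are irrelevant.\<close>

definition invariant_curve ::
  "(real \<times> real \<Rightarrow> real \<times> real) \<Rightarrow> real \<Rightarrow> (real \<Rightarrow> real) \<Rightarrow> bool" where
  "invariant_curve T a g \<longleftrightarrow>
    continuous_on {0..a} g \<and> g \<in> {0..a} \<rightarrow> {0..} \<and> T ` curve a g \<subseteq> curve a g"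

definition above_curve :: "real \<Rightarrow> (real \<Rightarrow> real) \<Rightarrow> real \<times> real \<Rightarrow> bool" where
  "above_curve a g = (\<lambda>(x1, x2). (0 \<le> x1 \<and> x1 \<le> a \<and> g x1 < x2) \<or> a < x1)"

end

theory Submission
  imports Defs "HOL-Real_Asymp.Real_Asymp"
begin

text \<open>The map is homogeneous of degree two, so on the punctured quadrant the limit
  \<open>G z = lim ln (N (F\<^sup>n z)) / 2\<^sup>n\<close>, with \<open>N (x, y) = x + y\<close>, exists, is continuous and
  satisfies \<open>G (F z) = 2 G z\<close> and \<open>G (c z) = ln c + G z\<close>. Orbits tend to \<open>0\<close> where \<open>G < 0\<close> and
  to infinity where \<open>G > 0\<close>. The map is monotone, which makes \<open>G\<close> strictly increasing in each
  coordinate, so the level set \<open>G = 0\<close> is the required curve. On the level set a point is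
  determined by its direction, and the induced dynamics of directions is monotone; the limit of
  an orbit is therefore the fixed point in the limiting direction.\<close>

section \<open>Homogeneous quadratic maps of the quadrant\<close>

locale quadratic_map =
  fixes p q r s :: real
  assumes pos: "0 < p" "0 < q" "0 < r" "0 < s"
begin

definition F :: "real \<times> real \<Rightarrow> real \<times> real" where
  "F = (\<lambda>(x, y). (x * (p * x + q * y), y * (r * x + s * y)))"

definition N :: "real \<times> real \<Rightarrow> real" where
  "N z = fst z + snd z"

text \<open>The origin is removed so that \<open>ln (N z)\<close> makes sense along whole
  orbits.\<close>

definition Q :: "(real \<times> real) set" where
  "Q = quadrant - {(0, 0)}"

lemma mem_Q_iff: "(x, y) \<in> Q \<longleftrightarrow> 0 \<le> x \<and> 0 \<le> y \<and> (0 < x \<or> 0 < y)"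
  by (auto simp: Q_def quadrant_def)

lemma N_pos: "z \<in> Q \<Longrightarrow> 0 < N z"
  by (cases z) (auto simp: mem_Q_iff N_def)

lemma F_in_Q: "z \<in> Q \<Longrightarrow> F z \<in> Q"
  using pos
  by (cases z) (auto simp: mem_Q_iff F_def zero_less_mult_iff add_nonneg_pos add_pos_nonneg)

lemma funpow_F_in_Q: "z \<in> Q \<Longrightarrow> (F ^^ n) z \<in> Q"
  by (induction n) (auto simp: F_in_Q)

lemma scaleR_in_Q: "0 < c \<Longrightarrow> z \<in> Q \<Longrightarrow> c *\<^sub>R z \<in> Q"
  by (cases z) (auto simp: mem_Q_iff)

lemma F_scaleR: "F (c *\<^sub>R z) = c\<^sup>2 *\<^sub>R F z"
  by (cases z) (auto simp: F_def algebra_simps power2_eq_square)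

lemma funpow_F_scaleR: "(F ^^ n) (c *\<^sub>R z) = c ^ (2 ^ n) *\<^sub>R (F ^^ n) z"
  by (induction n) (auto simp: F_scaleR power_even_eq)

lemma N_scaleR: "N (c *\<^sub>R z) = c * N z"
  by (simp add: N_def algebra_simps)

lemma continuous_on_F: "continuous_on A F"
  unfolding F_def case_prod_beta by (intro continuous_intros)

lemma continuous_on_funpow_F: "continuous_on A (F ^^ n)"
proof (induction n)
  case (Suc n)
  then show ?case
    using continuous_on_compose[OF Suc continuous_on_F] by (simp add: o_def)
qed (simp add: continuous_on_id)

lemma continuous_on_N: "continuous_on A N"
  unfolding N_def by (intro continuous_intros)

section \<open>The logarithmic growth rate\<close>

text \<open>The deviation of \<open>F\<close> from exactly squaring \<open>N\<close>; on
  \<open>Q\<close> it depends only on the direction of \<open>z\<close>, by homogeneity.\<close>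

definition h :: "real \<times> real \<Rightarrow> real" where
  "h z = ln (N (F z)) - 2 * ln (N z)"

definition B :: real where
  "B = \<bar>ln (min (min p q) (min r s))\<bar> + \<bar>ln (max (max p q) (max r s))\<bar>"

text \<open>\<open>N (F z)\<close> is a quadratic form with positive coefficients, so it lies
  between multiples of \<open>(N z)\<^sup>2\<close> by the least and the greatest of
  \<open>p\<close>, \<open>q\<close>, \<open>r\<close>, \<open>s\<close>; \<open>h\<close> is the
  logarithm of the ratio.\<close>

lemma abs_h_le:
  assumes "z \<in> Q"
  shows "\<bar>h z\<bar> \<le> B"
proof -
  obtain x y where z: "z = (x, y)" and xy: "0 \<le> x" "0 \<le> y"
    using assms by (cases z) (auto simp: mem_Q_iff)
  define k where "k = min (min p q) (min r s)"
  define K where "K = max (max p q) (max r s)"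
  have k: "0 < k" "k \<le> p" "k \<le> q" "k \<le> r" "k \<le> s"
    and K: "0 < K" "p \<le> K" "q \<le> K" "r \<le> K" "s \<le> K"
    using pos by (auto simp: k_def K_def)
  have NF: "N (F z) = p * (x * x) + (q + r) * (x * y) + s * (y * y)"
    by (simp add: N_def F_def z algebra_simps)
  \<comment> \<open>The cross coefficient stays \<open>c + c\<close> so that it compares with
    \<open>q + r\<close> summand by summand.\<close>
  have N2: "c * (N z)\<^sup>2 = c * (x * x) + (c + c) * (x * y) + c * (y * y)" for c
    by (simp add: N_def z algebra_simps power2_eq_square)
  have "k * (N z)\<^sup>2 \<le> N (F z)"
    unfolding NF N2 using k xy by (intro add_mono mult_right_mono) auto
  moreover have "N (F z) \<le> K * (N z)\<^sup>2"
    unfolding NF N2 using K xy by (intro add_mono mult_right_mono) auto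
  moreover have "0 < N z" "0 < N (F z)"
    using assms by (auto intro: N_pos F_in_Q)
  moreover have "ln (c * (N z)\<^sup>2) = ln c + 2 * ln (N z)" if "0 < c" for c
    using that \<open>0 < N z\<close> by (simp add: ln_mult ln_realpow)
  ultimately have "ln k + 2 * ln (N z) \<le> ln (N (F z))" "ln (N (F z)) \<le> ln K + 2 * ln (N z)"
    using k(1) K(1) ln_mono[of "k * (N z)\<^sup>2" "N (F z)"] ln_mono[of "N (F z)" "K * (N z)\<^sup>2"]
    by simp_all
  then show ?thesis
    unfolding h_def B_def k_def K_def by linarith
qed

text \<open>The partial sums telescope: \<open>ln (N z)\<close> plus the first \<open>n\<close> terms is
  \<open>ln (N (F\<^sup>n z)) / 2\<^sup>n\<close>.\<close>

definition G :: "real \<times> real \<Rightarrow> real" where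
  "G z = ln (N z) + (\<Sum>n. h ((F ^^ n) z) / 2 ^ Suc n)"

lemma sums_B: "(\<lambda>n. B / 2 ^ Suc n) sums B"
  using sums_mult[OF power_half_series, of B] by (simp add: power_one_over)

lemma norm_term_le: "z \<in> Q \<Longrightarrow> norm (h ((F ^^ n) z) / 2 ^ Suc n) \<le> B / 2 ^ Suc n"
  using abs_h_le[OF funpow_F_in_Q, of z n] by (simp add: divide_right_mono)

lemma summable_terms: "z \<in> Q \<Longrightarrow> summable (\<lambda>n. h ((F ^^ n) z) / 2 ^ Suc n)"
  by (rule summable_comparison_test'[OF sums_summable[OF sums_B], of 0]) (rule norm_term_le)

text \<open>The weights \<open>1 / 2 ^ Suc n\<close> sum to one, so the series inherits the bound
  \<open>B\<close> on \<open>h\<close>.\<close>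

lemma G_diff_ln_N:
  assumes "z \<in> Q"
  shows "\<bar>G z - ln (N z)\<bar> \<le> B"
proof -
  have "norm (\<Sum>n. h ((F ^^ n) z) / 2 ^ Suc n) \<le> (\<Sum>n. B / 2 ^ Suc n)"
    by (rule norm_suminf_le[OF norm_term_le[OF assms] sums_summable[OF sums_B]])
  then show ?thesis
    using sums_unique[OF sums_B] by (simp add: G_def)
qed

text \<open>Passing to \<open>F z\<close> shifts the series by one index and doubles its weights;
  the missing first term \<open>h z / 2\<close> turns \<open>ln (N (F z))\<close> into
  \<open>2 * ln (N z)\<close>.\<close>

lemma G_F:
  assumes "z \<in> Q"
  shows "G (F z) = 2 * G z"
proof -
  define t where "t n = h ((F ^^ n) z) / 2 ^ Suc n" for n
  have "summable t"
    unfolding t_def by (rule summable_terms[OF assms])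
  then have "(\<Sum>n. t (Suc n)) = suminf t - h z / 2"
    by (subst suminf_split_head) (auto simp: t_def)
  moreover have "(\<Sum>n. h ((F ^^ n) (F z)) / 2 ^ Suc n) = (\<Sum>n. 2 * t (Suc n))"
    by (simp add: t_def funpow_swap1)
  moreover have "(\<Sum>n. 2 * t (Suc n)) = 2 * (\<Sum>n. t (Suc n))"
    by (rule suminf_mult) (simp add: summable_Suc_iff \<open>summable t\<close>)
  ultimately show ?thesis
    unfolding G_def t_def[symmetric] by (simp add: h_def[of z] diff_divide_distrib)
qed

lemma G_funpow_F: "z \<in> Q \<Longrightarrow> G ((F ^^ n) z) = 2 ^ n * G z"
  by (induction n) (auto simp: G_F funpow_F_in_Q)

lemma G_fixed: "z \<in> Q \<Longrightarrow> F z = z \<Longrightarrow> G z = 0"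
  using G_F[of z] by simp

text \<open>Iterates of a scaled point keep their directions, so the series is unchanged and only
  \<open>ln (N z)\<close> moves.\<close>

lemma G_scaleR:
  assumes "0 < c" "z \<in> Q"
  shows "G (c *\<^sub>R z) = ln c + G z"
proof -
  have "h (d *\<^sub>R w) = h w" if "0 < d" "w \<in> Q" for d w
    using that N_pos[of w] N_pos[OF F_in_Q, of w]
    by (simp add: h_def F_scaleR N_scaleR ln_mult ln_realpow)
  then have "h ((F ^^ n) (c *\<^sub>R z)) = h ((F ^^ n) z)" for n
    using assms by (simp add: funpow_F_scaleR funpow_F_in_Q)
  then show ?thesis
    using assms N_pos[of z] by (simp add: G_def N_scaleR ln_mult)
qed

text \<open>The terms are continuous and dominated by \<open>B / 2 ^ Suc n\<close>, so the series
  converges uniformly on \<open>Q\<close>.\<close>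

lemma continuous_on_G: "continuous_on Q G"
proof -
  have "N z \<noteq> 0" "N (F z) \<noteq> 0" if "z \<in> Q" for z
    using N_pos[of z] N_pos[of "F z"] F_in_Q that by auto
  then have h: "continuous_on Q h"
    unfolding h_def
    by (intro continuous_intros continuous_on_compose2[OF continuous_on_N continuous_on_F]
        continuous_on_N) auto
  have "uniform_limit Q (\<lambda>n z. \<Sum>i<n. h ((F ^^ i) z) / 2 ^ Suc i)
      (\<lambda>z. \<Sum>i. h ((F ^^ i) z) / 2 ^ Suc i) sequentially"
    by (rule Weierstrass_m_test[OF norm_term_le sums_summable[OF sums_B]])
  then have "continuous_on Q (\<lambda>z. \<Sum>i. h ((F ^^ i) z) / 2 ^ Suc i)"
    by (rule uniform_limit_theorem[rotated])
      (auto intro!: always_eventually continuous_intros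
        continuous_on_compose2[OF h continuous_on_funpow_F] funpow_F_in_Q)
  then show ?thesis
    unfolding G_def
    by (intro continuous_intros continuous_on_N) (auto dest: N_pos)
qed

section \<open>Decay and blow-up off the level set\<close>

text \<open>At the \<open>n\<close>-th iterate \<open>G\<close> has become
  \<open>2 ^ n * G z\<close>, yet it still differs from \<open>ln N\<close> by at most
  \<open>B\<close>.\<close>

lemma N_funpow_bounds:
  assumes "z \<in> Q"
  shows "exp (2 ^ n * G z - B) \<le> N ((F ^^ n) z)" "N ((F ^^ n) z) \<le> exp (2 ^ n * G z + B)"
proof -
  define u where "u = N ((F ^^ n) z)"
  have "0 < u"
    using N_pos[OF funpow_F_in_Q[OF assms]] by (simp add: u_def)
  have "\<bar>2 ^ n * G z - ln u\<bar> \<le> B"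
    using G_diff_ln_N[OF funpow_F_in_Q[OF assms]] by (simp add: G_funpow_F assms u_def)
  then have "exp (2 ^ n * G z - B) \<le> exp (ln u)" "exp (ln u) \<le> exp (2 ^ n * G z + B)"
    by simp_all
  with \<open>0 < u\<close> show "exp (2 ^ n * G z - B) \<le> N ((F ^^ n) z)"
    and "N ((F ^^ n) z) \<le> exp (2 ^ n * G z + B)"
    by (simp_all add: u_def)
qed

lemma tendsto_zero_if_G_neg:
  assumes "z \<in> Q" "G z < 0"
  shows "(\<lambda>n. (F ^^ n) z) \<longlonglongrightarrow> (0, 0)"
proof -
  have "LIM n sequentially. 2 ^ n * G z + B :> at_bot"
    using assms by real_asymp
  then have lim: "(\<lambda>n. exp (2 ^ n * G z + B)) \<longlonglongrightarrow> 0"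
    by (rule filterlim_compose[OF exp_at_bot])
  have "norm ((F ^^ n) z) \<le> exp (2 ^ n * G z + B)" for n
  proof -
    have "norm ((F ^^ n) z) \<le> N ((F ^^ n) z)"
      using funpow_F_in_Q[OF assms(1), of n]
      by (cases "(F ^^ n) z") (simp add: N_def mem_Q_iff order_trans[OF norm_Pair_le])
    then show ?thesis
      using N_funpow_bounds(2)[OF assms(1), of n] by linarith
  qed
  then have "(\<lambda>n. (F ^^ n) z) \<longlonglongrightarrow> 0"
    by (intro Lim_null_comparison[OF _ lim]) auto
  then show ?thesis
    by (simp add: zero_prod_def)
qed

lemma norm_at_top_if_G_pos:
  assumes "z \<in> Q" "0 < G z"
  shows "LIM n sequentially. norm ((F ^^ n) z) :> at_top"
proof -
  have "LIM n sequentially. exp (2 ^ n * G z - B) / 2 :> at_top"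
    using assms by real_asymp
  moreover have "exp (2 ^ n * G z - B) / 2 \<le> norm ((F ^^ n) z)" for n
  proof -
    have "N ((F ^^ n) z) \<le> 2 * norm ((F ^^ n) z)"
      using norm_fst_le[of "fst ((F ^^ n) z)" "snd ((F ^^ n) z)"]
        norm_snd_le[of "snd ((F ^^ n) z)" "fst ((F ^^ n) z)"]
      by (simp add: N_def)
    then show ?thesis
      using N_funpow_bounds(1)[OF assms(1), of n] by linarith
  qed
  ultimately show ?thesis
    by (auto intro: filterlim_at_top_mono always_eventually)
qed

section \<open>Monotonicity of the growth rate\<close>

lemma F_mono:
  assumes "z \<in> Q" "fst z \<le> fst w" "snd z \<le> snd w"
  shows "fst (F z) \<le> fst (F w)" "snd (F z) \<le> snd (F w)"
proof -
  obtain x y x' y' where zw: "z = (x, y)" "w = (x', y')"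
    by (cases z; cases w)
  then have le: "0 \<le> x" "0 \<le> y" "x \<le> x'" "y \<le> y'"
    using assms by (auto simp: mem_Q_iff)
  then have "p * x + q * y \<le> p * x' + q * y'" "r * x + s * y \<le> r * x' + s * y'"
    using pos by (intro add_mono mult_left_mono; simp)+
  moreover have "0 \<le> p * x + q * y" "0 \<le> r * x + s * y"
    using le pos by simp_all
  ultimately show "fst (F z) \<le> fst (F w)" "snd (F z) \<le> snd (F w)"
    using le by (auto simp: zw F_def intro: mult_mono)
qed

lemma in_Q_mono: "z \<in> Q \<Longrightarrow> fst z \<le> fst w \<Longrightarrow> snd z \<le> snd w \<Longrightarrow> w \<in> Q"
  by (cases z; cases w) (auto simp: mem_Q_iff)

text \<open>All iterates of \<open>F\<close> preserve the coordinatewise order. A positive gap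
  \<open>G z - G w\<close> would double at each step, while the bounds on \<open>N\<close> keep it
  at most \<open>2 * B\<close>.\<close>

lemma G_mono:
  assumes z: "z \<in> Q" and le: "fst z \<le> fst w" "snd z \<le> snd w"
  shows "G z \<le> G w"
proof (rule ccontr)
  assume "\<not> G z \<le> G w"
  then have gap: "0 < G z - G w"
    by simp
  have w: "w \<in> Q"
    using in_Q_mono assms by blast
  have "fst ((F ^^ n) z) \<le> fst ((F ^^ n) w) \<and> snd ((F ^^ n) z) \<le> snd ((F ^^ n) w)" for n
    by (induction n) (auto simp: le intro!: F_mono funpow_F_in_Q z)
  then have "N ((F ^^ n) z) \<le> N ((F ^^ n) w)" for n
    unfolding N_def by (meson add_mono)
  then have "exp (2 ^ n * G z - B) \<le> exp (2 ^ n * G w + B)" for n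
    using N_funpow_bounds(1)[OF z, of n] N_funpow_bounds(2)[OF w, of n] by (meson order_trans)
  then have "2 ^ n * (G z - G w) \<le> 2 * B" for n
    by (simp add: algebra_simps)
  moreover obtain n where "2 * B / (G z - G w) < 2 ^ n"
    using real_arch_pow[of 2 "2 * B / (G z - G w)"] by auto
  ultimately show False
    using gap by (metis divide_less_eq not_less)
qed

text \<open>One application of \<open>F\<close> turns a strict increase of the second coordinate into a strict
  increase of both, hence into a gain by a factor \<open>c > 1\<close>.\<close>

lemma G_strict_mono_snd:
  assumes xy: "(x, y) \<in> Q" and less: "y < y'"
  shows "G (x, y) < G (x, y')"
proof -
  have y: "0 \<le> y" "0 \<le> x"
    using xy by (auto simp: mem_Q_iff)
  have *: "(x, y') \<in> Q"
    using xy less by (auto simp: mem_Q_iff)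
  show ?thesis
  \<comment> \<open>On the axis \<open>x = 0\<close> the first coordinate stays zero, but there
    raising \<open>y\<close> is a scaling.\<close>
  proof (cases "x = 0")
    case True
    then have "0 < y"
      using xy by (auto simp: mem_Q_iff)
    then have "G (x, y') = ln (y' / y) + G (x, y)"
      using G_scaleR[of "y' / y" "(x, y)"] xy less True by simp
    moreover have "0 < ln (y' / y)"
      using \<open>0 < y\<close> less by (intro ln_gt_zero) (simp add: field_simps)
    ultimately show ?thesis
      by simp
  next
    case False
    with y have x: "0 < x"
      by simp
    obtain a b where ab: "F (x, y) = (a, b)" by (cases "F (x, y)")
    obtain a' b' where ab': "F (x, y') = (a', b')" by (cases "F (x, y')")
    have a: "0 < a" "a < a'"
      using ab ab' x y less pos by (auto simp: F_def intro!: mult_pos_pos add_pos_nonneg)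
    have b: "0 \<le> b" "b < b'"
    proof -
      show "0 \<le> b"
        using ab x y pos by (auto simp: F_def)
      have "y * (r * x + s * y) \<le> y * (r * x + s * y')"
        using less y pos by (intro mult_left_mono) auto
      also have "\<dots> < y' * (r * x + s * y')"
        using less x y pos by (intro mult_strict_right_mono add_pos_nonneg) auto
      finally show "b < b'"
        using ab ab' by (auto simp: F_def)
    qed
    \<comment> \<open>A growth factor common to both coordinates; if \<open>b = 0\<close> the second
      imposes no constraint, and \<open>2\<close> is an arbitrary value above one.\<close>
    define c where "c = min (a' / a) (if b = 0 then 2 else b' / b)"
    have c: "1 < c"
      using a b by (auto simp: c_def)
    have "c * a \<le> a'"
      using a mult_right_mono[of c "a' / a" a] by (auto simp: c_def)
    moreover have "c * b \<le> b'"
      using b mult_right_mono[of c "b' / b" b] by (cases "b = 0") (auto simp: c_def)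
    ultimately have "G (c *\<^sub>R (a, b)) \<le> G (a', b')"
      using F_in_Q[OF xy] c by (intro G_mono scaleR_in_Q) (auto simp: ab)
    moreover have "G (c *\<^sub>R (a, b)) = ln c + G (a, b)"
      using F_in_Q[OF xy] c by (intro G_scaleR) (auto simp: ab)
    moreover have "0 < ln c"
      using c by simp
    ultimately have "G (F (x, y)) < G (F (x, y'))"
      by (simp add: ab ab')
    then show ?thesis
      using G_F xy * by simp
  qed
qed

lemma G_strict_mono_snd_iff:
  assumes "(x, y) \<in> Q" "(x, y') \<in> Q"
  shows "G (x, y) < G (x, y') \<longleftrightarrow> y < y'"
  using G_strict_mono_snd[OF assms(1), of y'] G_strict_mono_snd[OF assms(2), of y]
  by (metis less_asym less_irrefl linorder_less_linear)

section \<open>The zero level set as a graph\<close>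

text \<open>Each axis point is a multiple of the fixed point \<open>(1 / p, 0)\<close>, where
  \<open>G\<close> vanishes.\<close>

lemma G_axis1: "0 < x \<Longrightarrow> G (x, 0) = ln (p * x)"
  using G_scaleR[of "p * x" "(1 / p, 0)"] G_fixed[of "(1 / p, 0)"] pos
  by (auto simp: mem_Q_iff F_def field_simps)

lemma G_axis2: "0 < y \<Longrightarrow> G (0, y) = ln (s * y)"
  using G_scaleR[of "s * y" "(0, 1 / s)"] G_fixed[of "(0, 1 / s)"] pos
  by (auto simp: mem_Q_iff F_def field_simps)

text \<open>Projecting to the axis can only lower \<open>G\<close>, and \<open>ln (p * x)\<close> is
  already positive.\<close>

lemma G_pos_if_fst_gt:
  assumes "(x, y) \<in> Q" "1 / p < x"
  shows "0 < G (x, y)"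
proof -
  have "0 < x"
    using assms(2) pos by (meson less_trans zero_less_divide_1_iff)
  then have "0 < G (x, 0)"
    using assms pos by (auto simp: G_axis1 field_simps)
  also have "\<dots> \<le> G (x, y)"
    using assms \<open>0 < x\<close> by (intro G_mono) (auto simp: mem_Q_iff)
  finally show ?thesis .
qed

lemma G_pos_if_snd_gt:
  assumes "(x, y) \<in> Q" "1 / s < y"
  shows "0 < G (x, y)"
proof -
  have "0 < y"
    using assms(2) pos by (meson less_trans zero_less_divide_1_iff)
  then have "0 < G (0, y)"
    using assms pos by (auto simp: G_axis2 field_simps)
  also have "\<dots> \<le> G (x, y)"
    using assms \<open>0 < y\<close> by (intro G_mono) (auto simp: mem_Q_iff)
  finally show ?thesis .
qed

text \<open>Well defined for \<open>0 \<le> x \<le> 1 / p\<close> by \<open>g_level\<close>; over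
  other \<open>x\<close> the level set is empty.\<close>

definition g :: "real \<Rightarrow> real" where
  "g x = (THE y. (x, y) \<in> Q \<and> G (x, y) = 0)"

text \<open>Intermediate value theorem on a vertical segment: \<open>G\<close> is at most zero on
  the axis and at least zero at height \<open>1 / s\<close>, by comparison with the fixed point
  \<open>(0, 1 / s)\<close>.\<close>

lemma ex_level_point:
  assumes "0 \<le> x" "x \<le> 1 / p"
  shows "\<exists>y. (x, y) \<in> Q \<and> G (x, y) = 0"
\<comment> \<open>For \<open>x = 0\<close> the segment would start at the origin, outside
  \<open>Q\<close>.\<close>
proof (cases "x = 0")
  case True
  then show ?thesis
    using pos by (intro exI[of _ "1 / s"]) (auto simp: mem_Q_iff G_axis2)
next
  case False
  with assms have x: "0 < x"
    by simp
  have "continuous_on {0..1 / s} (\<lambda>y. G (x, y))"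
    using x by (intro continuous_on_compose2[OF continuous_on_G] continuous_intros)
      (auto simp: mem_Q_iff)
  moreover have "G (x, 0) \<le> 0"
    using x assms pos by (simp add: G_axis1 field_simps)
  moreover have "0 \<le> G (x, 1 / s)"
    using G_mono[of "(0, 1 / s)" "(x, 1 / s)"] x pos by (simp add: G_axis2 mem_Q_iff)
  ultimately obtain y where "0 \<le> y" "G (x, y) = 0"
    using IVT'[of "\<lambda>y. G (x, y)" 0 0 "1 / s"] pos by auto
  then show ?thesis
    using x by (auto simp: mem_Q_iff)
qed

lemma g_level:
  assumes "0 \<le> x" "x \<le> 1 / p"
  shows "(x, g x) \<in> Q" "G (x, g x) = 0"
proof -
  have "\<exists>!y. (x, y) \<in> Q \<and> G (x, y) = 0"
    using ex_level_point[OF assms] G_strict_mono_snd by (metis less_irrefl linorder_neqE_linordered_idom)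
  then show "(x, g x) \<in> Q" "G (x, g x) = 0"
    unfolding g_def by (metis (mono_tags, lifting) theI')+
qed

text \<open>Strict monotonicity leaves one zero of \<open>G\<close> over each \<open>x\<close> up to
  \<open>1 / p\<close>, and none lies beyond. Invariance of the curve and membership of fixed points
  thus reduce to identities for \<open>G\<close>.\<close>

lemma mem_curve_iff: "z \<in> curve (1 / p) g \<longleftrightarrow> z \<in> Q \<and> G z = 0"
proof
  assume "z \<in> curve (1 / p) g"
  then show "z \<in> Q \<and> G z = 0"
    by (auto simp: curve_def g_level)
next
  assume *: "z \<in> Q \<and> G z = 0"
  obtain x y where z: "z = (x, y)" by (cases z)
  have x: "0 \<le> x" "x \<le> 1 / p"
    using * G_pos_if_fst_gt[of x y] by (force simp: z mem_Q_iff not_less[symmetric])+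
  then have "y = g x"
    using * g_level[OF x] G_strict_mono_snd unfolding z
    by (metis less_irrefl linorder_neqE_linordered_idom)
  with x show "z \<in> curve (1 / p) g"
    by (auto simp: z curve_def)
qed

text \<open>A map into a compact interval with closed graph is continuous, so it suffices that the
  zero set of \<open>G\<close> is closed.\<close>

lemma continuous_on_g: "continuous_on {0..1 / p} g"
proof (rule continuous_from_closed_graph)
  show "g \<in> {0..1 / p} \<rightarrow> {0..1 / s}"
  proof
    fix x assume "x \<in> {0..1 / p}"
    then show "g x \<in> {0..1 / s}"
      using g_level[of x] G_pos_if_snd_gt[of x "g x"] by (force simp: mem_Q_iff)
  qed
  \<comment> \<open>\<open>Q\<close> is not closed at the origin, but \<open>G z = 0\<close> forces
    \<open>exp (- B) \<le> N z\<close>; this closed set lies in \<open>Q\<close> and contains the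
    whole zero set.\<close>
  let ?K = "{z. 0 \<le> fst z \<and> 0 \<le> snd z \<and> exp (- B) \<le> N z}"
  have KQ: "?K \<subseteq> Q"
    by (force simp: N_def Q_def quadrant_def not_le)
  have "(\<lambda>x. (x, g x)) ` {0..1 / p} = curve (1 / p) g"
    by (simp add: curve_def)
  also have "\<dots> = {z \<in> ?K. G z = 0}"
  proof -
    have "z \<in> ?K" if "z \<in> Q" "G z = 0" for z
      using that N_funpow_bounds(1)[of z 0] by (cases z) (auto simp: mem_Q_iff)
    then show ?thesis
      using KQ by (auto simp: set_eq_iff mem_curve_iff)
  qed
  finally have eq: "(\<lambda>x. (x, g x)) ` {0..1 / p} = {z \<in> ?K. G z = 0}" .
  have "closed ?K"
    unfolding N_def by (intro closed_Collect_conj closed_Collect_le continuous_intros)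
  then show "closed ((\<lambda>x. (x, g x)) ` {0..1 / p})"
    unfolding eq
    using continuous_closed_preimage_constant[OF continuous_on_subset[OF continuous_on_G KQ]]
    by blast
qed auto

lemma invariant_curve_g: "invariant_curve F (1 / p) g"
  unfolding invariant_curve_def
proof (intro conjI)
  show "g \<in> {0..1 / p} \<rightarrow> {0..}"
    using g_level by (auto simp: mem_Q_iff)
  show "F ` curve (1 / p) g \<subseteq> curve (1 / p) g"
    by (auto simp: mem_curve_iff F_in_Q G_F)
qed (rule continuous_on_g)

lemma G_neg_if_below:
  assumes "(x, y) \<in> Q" "x \<le> 1 / p" "y < g x"
  shows "G (x, y) < 0"
  using assms G_strict_mono_snd[of x y "g x"] g_level[of x] by (auto simp: mem_Q_iff)

lemma G_pos_if_above:
  assumes "(x, y) \<in> Q" "above_curve (1 / p) g (x, y)"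
  shows "0 < G (x, y)"
  using assms G_strict_mono_snd[of x "g x" y] g_level[of x] G_pos_if_fst_gt
  by (auto simp: above_curve_def)

section \<open>Convergence on the level set\<close>

text \<open>The direction, encoded by the share of the second coordinate in \<open>N\<close>, is
  monotone and bounded, so it converges. On the zero set of \<open>G\<close> the size is a
  continuous function of the direction, so the orbit converges too, and continuity of
  \<open>F\<close> makes its limit fixed.\<close>

lemma funpow_F_converges:
  assumes z: "z \<in> Q" "G z = 0"
    and mono: "monoseq (\<lambda>n. snd ((F ^^ n) z) / N ((F ^^ n) z))"
  obtains e where "e \<in> Q" "F e = e" "(\<lambda>n. (F ^^ n) z) \<longlonglongrightarrow> e"
    "(\<lambda>n. snd ((F ^^ n) z) / N ((F ^^ n) z)) \<longlonglongrightarrow> snd e / N e"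
proof -
  define Z where "Z n = (F ^^ n) z" for n
  define d where "d n = snd (Z n) / N (Z n)" for n
  have ZQ: "Z n \<in> Q" and GZ: "G (Z n) = 0" for n
    using z by (auto simp: Z_def funpow_F_in_Q G_funpow_F)
  have NZ: "0 < N (Z n)" for n
    using ZQ N_pos by blast
  have d01: "0 \<le> d n" "d n \<le> 1" for n
    using ZQ[of n] NZ[of n] by (cases "Z n"; auto simp: d_def N_def mem_Q_iff)+
  then have "Bseq d"
    by (intro BseqI'[of d 1]) auto
  moreover have "monoseq d"
    using mono unfolding d_def Z_def .
  ultimately obtain l where l: "d \<longlonglongrightarrow> l"
    using Bseq_monoseq_convergent unfolding convergent_def by blast
  have l01: "0 \<le> l" "l \<le> 1"
    using d01 by (auto intro: LIMSEQ_le_const[OF l] LIMSEQ_le_const2[OF l])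
  define w where "w = (1 - l, l)"
  have wQ: "w \<in> Q"
    using l01 by (auto simp: w_def mem_Q_iff)
  have dir: "(1 - d n, d n) = (1 / N (Z n)) *\<^sub>R Z n" for n
    using NZ[of n] by (cases "Z n") (auto simp: d_def N_def field_simps)
  have lim_dir: "(\<lambda>n. (1 - d n, d n)) \<longlonglongrightarrow> w"
    unfolding w_def by (intro tendsto_intros l)
  moreover have "(1 - d n, d n) \<in> Q" for n
    unfolding dir using NZ[of n] ZQ[of n] by (simp add: scaleR_in_Q)
  ultimately have "(\<lambda>n. G (1 - d n, d n)) \<longlonglongrightarrow> G w"
    by (intro continuous_on_tendsto_compose[OF continuous_on_G _ wQ]) auto
  then have "(\<lambda>n. exp (- G (1 - d n, d n))) \<longlonglongrightarrow> exp (- G w)"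
    by (intro tendsto_intros)
  \<comment> \<open>Since \<open>G (Z n) = 0\<close>, normalising \<open>Z n\<close> to
    \<open>N = 1\<close> changes \<open>G\<close> to \<open>- ln (N (Z n))\<close>: the direction
    determines the size.\<close>
  moreover have "exp (- G (1 - d n, d n)) = N (Z n)" for n
    unfolding dir using NZ[of n] ZQ[of n] GZ[of n] by (simp add: G_scaleR ln_div)
  ultimately have limN: "(\<lambda>n. N (Z n)) \<longlonglongrightarrow> exp (- G w)"
    by simp
  define e where "e = exp (- G w) *\<^sub>R w"
  have "(\<lambda>n. N (Z n) *\<^sub>R (1 - d n, d n)) \<longlonglongrightarrow> e"
    unfolding e_def by (intro tendsto_scaleR limN lim_dir)
  moreover have "N (Z n) *\<^sub>R (1 - d n, d n) = Z n" for n
    unfolding dir using NZ[of n] by simp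
  ultimately have Ze: "Z \<longlonglongrightarrow> e"
    by simp
  have "(\<lambda>n. F (Z n)) \<longlonglongrightarrow> F e"
    by (rule continuous_on_tendsto_compose[OF continuous_on_F[of UNIV] Ze]) auto
  moreover have "(\<lambda>n. F (Z n)) \<longlonglongrightarrow> e"
    using LIMSEQ_Suc[OF Ze] by (simp add: Z_def)
  ultimately have "F e = e"
    using LIMSEQ_unique by blast
  moreover have "e \<in> Q"
    using wQ by (simp add: e_def scaleR_in_Q)
  moreover have "snd e / N e = l"
    by (simp add: e_def w_def N_def flip: distrib_left)
  ultimately show thesis
    using that Ze l unfolding Z_def d_def by blast
qed

section \<open>Monotone dynamics of directions\<close>

text \<open>The difference \<open>(r * x + s * y) - (p * x + q * y)\<close> of the factors by which
  \<open>F\<close> multiplies the two coordinates; its sign tells towards which axis the direction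
  turns.\<close>

definition D :: "real \<times> real \<Rightarrow> real" where
  "D z = (r - p) * fst z + (s - q) * snd z"

text \<open>Both sides have the mixed coefficient \<open>r * s - p * q\<close>. The cofactor is
  positive on \<open>Q\<close>, so the sign of \<open>D\<close> is kept along orbits.\<close>

lemma D_F: "D (F (x, y)) = D (x, y) * (p * x + s * y)"
  by (simp add: D_def F_def algebra_simps)

text \<open>After cross-multiplication the change of direction is \<open>x * y * D z\<close> over a
  positive denominator.\<close>

lemma direction_F:
  assumes "z \<in> Q"
  shows "0 \<le> D z \<Longrightarrow> snd z / N z \<le> snd (F z) / N (F z)"
    and "D z \<le> 0 \<Longrightarrow> snd (F z) / N (F z) \<le> snd z / N z"
proof -
  obtain x y where z: "z = (x, y)" by (cases z)
  have N: "0 < N z" "0 < N (F z)"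
    using assms by (auto intro: N_pos F_in_Q)
  have diff: "snd (F z) * N z - snd z * N (F z) = (x * y) * D z"
    by (simp add: z F_def N_def D_def algebra_simps)
  have frac: "a / b \<le> c / d \<longleftrightarrow> a * d \<le> c * b" if "0 < b" "0 < d" for a b c d :: real
    using that by (simp add: field_simps)
  have xy: "0 \<le> x * y"
    using assms by (simp add: z mem_Q_iff)
  show "snd z / N z \<le> snd (F z) / N (F z)" if "0 \<le> D z"
    using mult_nonneg_nonneg[OF xy that] diff by (simp add: frac N)
  show "snd (F z) / N (F z) \<le> snd z / N z" if "D z \<le> 0"
    using mult_nonneg_nonpos[OF xy that] diff by (simp add: frac N)
qed

lemma D_funpow_sign:
  assumes "z \<in> Q"
  shows "0 \<le> D z \<Longrightarrow> 0 \<le> D ((F ^^ n) z)" and "D z \<le> 0 \<Longrightarrow> D ((F ^^ n) z) \<le> 0"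
proof -
  have *: "0 \<le> p * fst w + s * snd w" "D (F w) = D w * (p * fst w + s * snd w)" if "w \<in> Q" for w
    using that pos D_F by (cases w; auto simp: mem_Q_iff)+
  show "0 \<le> D z \<Longrightarrow> 0 \<le> D ((F ^^ n) z)"
    by (induction n) (auto simp: * funpow_F_in_Q assms)
  show "D z \<le> 0 \<Longrightarrow> D ((F ^^ n) z) \<le> 0"
    by (induction n) (auto simp: * funpow_F_in_Q assms mult_nonpos_nonneg)
qed

lemma tendsto_D: "Z \<longlonglongrightarrow> e \<Longrightarrow> (\<lambda>n. D (Z n)) \<longlonglongrightarrow> D e"
  unfolding D_def by (intro tendsto_intros)

text \<open>Both multipliers equal one at such a point, so their difference vanishes.\<close>

lemma fixed_point_D:
  assumes "F (x, y) = (x, y)" "x \<noteq> 0" "y \<noteq> 0"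
  shows "D (x, y) = 0"
  using assms by (simp add: F_def D_def) (simp add: algebra_simps)

text \<open>The share of the second coordinate starts positive and never decreases, so the limit
  keeps off the first axis; the weak inequality on \<open>D\<close> survives the limit.\<close>

lemma limit_if_D_nonneg:
  assumes z: "0 < fst z" "0 < snd z" "G z = 0" and D: "0 \<le> D z"
  obtains e where "F e = e" "(\<lambda>n. (F ^^ n) z) \<longlonglongrightarrow> e" "0 \<le> D e" "0 \<le> fst e" "0 < snd e"
proof -
  have zQ: "z \<in> Q"
    using z by (cases z) (auto simp: mem_Q_iff)
  have "incseq (\<lambda>n. snd ((F ^^ n) z) / N ((F ^^ n) z))"
    using direction_F(1) D_funpow_sign(1) D zQ by (intro incseq_SucI) (auto simp: funpow_F_in_Q)
  moreover from this obtain e where e: "e \<in> Q" "F e = e" "(\<lambda>n. (F ^^ n) z) \<longlonglongrightarrow> e"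
    "(\<lambda>n. snd ((F ^^ n) z) / N ((F ^^ n) z)) \<longlonglongrightarrow> snd e / N e"
    using funpow_F_converges[OF zQ z(3)] by (auto simp: monoseq_iff)
  ultimately have "snd z / N z \<le> snd e / N e"
    using incseq_le[of _ "snd e / N e" 0] by force
  moreover have "0 < snd z / N z"
    using z N_pos[OF zQ] by simp
  ultimately have "0 < snd e / N e"
    by linarith
  then have "0 < snd e"
    using N_pos[OF e(1)] by (simp add: zero_less_divide_iff)
  moreover have "0 \<le> D e"
    using D_funpow_sign(1)[OF zQ D] by (intro LIMSEQ_le_const[OF tendsto_D[OF e(3)]]) auto
  ultimately show thesis
    using that e by (cases e) (auto simp: mem_Q_iff)
qed

text \<open>Mirror image: the share of the second coordinate starts below one and never increases,
  so the limit keeps off the second axis.\<close>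

lemma limit_if_D_nonpos:
  assumes z: "0 < fst z" "0 < snd z" "G z = 0" and D: "D z \<le> 0"
  obtains e where "F e = e" "(\<lambda>n. (F ^^ n) z) \<longlonglongrightarrow> e" "D e \<le> 0" "0 < fst e" "0 \<le> snd e"
proof -
  have zQ: "z \<in> Q"
    using z by (cases z) (auto simp: mem_Q_iff)
  have "decseq (\<lambda>n. snd ((F ^^ n) z) / N ((F ^^ n) z))"
    using direction_F(2) D_funpow_sign(2) D zQ by (intro decseq_SucI) (auto simp: funpow_F_in_Q)
  moreover from this obtain e where e: "e \<in> Q" "F e = e" "(\<lambda>n. (F ^^ n) z) \<longlonglongrightarrow> e"
    "(\<lambda>n. snd ((F ^^ n) z) / N ((F ^^ n) z)) \<longlonglongrightarrow> snd e / N e"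
    using funpow_F_converges[OF zQ z(3)] by (auto simp: monoseq_iff)
  ultimately have "snd e / N e \<le> snd z / N z"
    using decseq_ge[of _ "snd e / N e" 0] by force
  moreover have "snd z / N z < 1"
    using z by (simp add: N_def)
  ultimately have "snd e / N e < 1"
    by linarith
  then have "0 < fst e"
    using N_pos[OF e(1)] by (simp add: N_def)
  moreover have "D e \<le> 0"
    using D_funpow_sign(2)[OF zQ D] by (intro LIMSEQ_le_const2[OF tendsto_D[OF e(3)]]) auto
  ultimately show thesis
    using that e by (cases e) (auto simp: mem_Q_iff)
qed

text \<open>Away from the origin \<open>D\<close> is positive on the first axis and negative on the
  second. The sign of \<open>D e\<close> therefore excludes one axis, and the monotone direction
  excludes the other.\<close>

lemma tendsto_interior_fixed_point:
  assumes "p < r" "s < q" "0 < fst z" "0 < snd z" "G z = 0"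
  obtains x y where "0 < x" "0 < y" "F (x, y) = (x, y)" "(\<lambda>n. (F ^^ n) z) \<longlonglongrightarrow> (x, y)"
proof (cases "0 \<le> D z")
  case True
  then obtain e where e: "F e = e" "(\<lambda>n. (F ^^ n) z) \<longlonglongrightarrow> e" "0 \<le> D e" "0 \<le> fst e" "0 < snd e"
    using limit_if_D_nonneg assms by blast
  have "fst e \<noteq> 0"
    using e(3,5) assms(2) mult_neg_pos[of "s - q" "snd e"] by (auto simp: D_def)
  with e that[of "fst e" "snd e"] show thesis
    by simp
next
  case False
  then obtain e where e: "F e = e" "(\<lambda>n. (F ^^ n) z) \<longlonglongrightarrow> e" "D e \<le> 0" "0 < fst e" "0 \<le> snd e"
    using limit_if_D_nonpos assms by (metis linear)
  have "snd e \<noteq> 0"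
    using e(3,4) assms(1) mult_pos_pos[of "r - p" "fst e"] by (auto simp: D_def not_le[symmetric])
  with e that[of "fst e" "snd e"] show thesis
    by simp
qed

text \<open>\<open>D\<close> is negative on the quadrant where \<open>0 < x\<close>, so the
  direction turns towards the first axis, and the limit cannot be an interior fixed point, where
  \<open>D\<close> would vanish.\<close>

lemma tendsto_axis1_fixed_point:
  assumes "r < p" "s < q" "0 < fst z" "0 < snd z" "G z = 0"
  shows "(\<lambda>n. (F ^^ n) z) \<longlonglongrightarrow> (1 / p, 0)"
proof -
  have neg: "D (x, y) < 0" if "0 < x" "0 \<le> y" for x y
    using assms that by (auto simp: D_def intro!: add_neg_nonpos mult_neg_pos mult_nonpos_nonneg)
  obtain x y where e: "F (x, y) = (x, y)" "(\<lambda>n. (F ^^ n) z) \<longlonglongrightarrow> (x, y)" "0 < x" "0 \<le> y"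
    using limit_if_D_nonpos[of z] neg[of "fst z" "snd z"] assms by (metis less_imp_le prod.collapse)
  then have "y = 0"
    using fixed_point_D[of x y] neg[of x y] by auto
  moreover from this e have "x = 1 / p"
    using pos by (auto simp: F_def field_simps)
  ultimately show ?thesis
    using e by simp
qed

lemma tendsto_axis2_fixed_point:
  assumes "p < r" "q < s" "0 < fst z" "0 < snd z" "G z = 0"
  shows "(\<lambda>n. (F ^^ n) z) \<longlonglongrightarrow> (0, 1 / s)"
proof -
  have nonneg: "0 < D (x, y)" if "0 \<le> x" "0 < y" for x y
    using assms that by (auto simp: D_def intro!: add_nonneg_pos mult_pos_pos mult_nonneg_nonneg)
  obtain x y where e: "F (x, y) = (x, y)" "(\<lambda>n. (F ^^ n) z) \<longlonglongrightarrow> (x, y)" "0 \<le> x" "0 < y"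
    using limit_if_D_nonneg[of z] nonneg[of "fst z" "snd z"] assms by (metis less_imp_le prod.collapse)
  then have "x = 0"
    using fixed_point_D[of x y] nonneg[of x y] by auto
  moreover from this e have "y = 1 / s"
    using pos by (auto simp: F_def field_simps)
  ultimately show ?thesis
    using e by simp
qed

section \<open>Fixed points on the curve and the fate of the orbits\<close>

lemma fixed_point_in_curve: "z \<in> Q \<Longrightarrow> F z = z \<Longrightarrow> z \<in> curve (1 / p) g"
  by (simp add: mem_curve_iff G_fixed)

lemma axis1_in_curve: "(1 / p, 0) \<in> curve (1 / p) g"
  and axis2_in_curve: "(0, 1 / s) \<in> curve (1 / p) g"
  using pos by (auto intro!: fixed_point_in_curve simp: mem_Q_iff F_def)

text \<open>The three regions lie in \<open>G < 0\<close>, \<open>G = 0\<close> and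
  \<open>G > 0\<close>. Only the middle limit depends on how the coefficients compare, hence the
  parameter \<open>e\<close>.\<close>

lemma orbit_trichotomy:
  assumes lim: "\<And>z. 0 < fst z \<Longrightarrow> 0 < snd z \<Longrightarrow> G z = 0 \<Longrightarrow> (\<lambda>n. (F ^^ n) z) \<longlonglongrightarrow> e"
    and x: "(x1, x2) \<in> quadrant \<and> F (x1, x2) \<noteq> (x1, x2)"
  shows "(0 \<le> x1 \<and> x1 < 1 / p \<and> 0 \<le> x2 \<and> x2 < g x1 \<longrightarrow>
        (\<lambda>n. (F ^^ n) (x1, x2)) \<longlonglongrightarrow> (0, 0)) \<and>
      (0 < x1 \<and> x1 < 1 / p \<and> x2 = g x1 \<longrightarrow> (\<lambda>n. (F ^^ n) (x1, x2)) \<longlonglongrightarrow> e) \<and>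
      (above_curve (1 / p) g (x1, x2) \<longrightarrow>
        filterlim (\<lambda>n. norm ((F ^^ n) (x1, x2))) at_top sequentially)"
proof -
  \<comment> \<open>The origin is a fixed point, so it is excluded as an initial point.\<close>
  have xQ: "(x1, x2) \<in> Q"
    using x by (auto simp: Q_def F_def)
  have 1: "0 \<le> x1 \<and> x1 < 1 / p \<and> 0 \<le> x2 \<and> x2 < g x1 \<longrightarrow> (\<lambda>n. (F ^^ n) (x1, x2)) \<longlonglongrightarrow> (0, 0)"
    using tendsto_zero_if_G_neg[OF xQ] G_neg_if_below[OF xQ] by simp
  have 2: "above_curve (1 / p) g (x1, x2) \<longrightarrow>
      filterlim (\<lambda>n. norm ((F ^^ n) (x1, x2))) at_top sequentially"
    using norm_at_top_if_G_pos[OF xQ] G_pos_if_above[OF xQ] by simp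
  have "0 < x1 \<and> x1 < 1 / p \<and> x2 = g x1 \<longrightarrow> (\<lambda>n. (F ^^ n) (x1, x2)) \<longlonglongrightarrow> e"
  proof (intro impI, elim conjE)
    assume *: "0 < x1" "x1 < 1 / p" "x2 = g x1"
    then have "G (x1, x2) = 0"
      using g_level[of x1] by simp
    \<comment> \<open>For \<open>x1 < 1 / p\<close> the axis lies below the curve, which makes
      \<open>x2\<close> positive as \<open>lim\<close> requires.\<close>
    moreover have "G (x1, 0) < 0"
      using * pos by (simp add: G_axis1 field_simps)
    ultimately have "0 < x2"
      using G_strict_mono_snd_iff[of x1 0 x2] xQ * by (simp add: mem_Q_iff)
    with * \<open>G (x1, x2) = 0\<close> show "(\<lambda>n. (F ^^ n) (x1, x2)) \<longlonglongrightarrow> e"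
      by (intro lim) auto
  qed
  with 1 2 show ?thesis
    by blast
qed

end

section \<open>The three parameter regimes of the given map\<close>

theorem theorem9:
  fixes \<theta>1 \<theta>2 :: real
  assumes "\<theta>1 > 0" and "\<theta>2 > 0"
  shows "(\<theta>1 < 2 * \<theta>2 \<and> \<theta>2 < 2 * \<theta>1 \<longrightarrow>
      (\<exists>\<gamma>. invariant_curve (H \<theta>1 \<theta>2) (2 / \<theta>1) \<gamma> \<and>
        E1 \<theta>1 \<in> curve (2 / \<theta>1) \<gamma> \<and> E2 \<theta>2 \<in> curve (2 / \<theta>1) \<gamma> \<and> Ebar \<theta>1 \<theta>2 \<in> curve (2 / \<theta>1) \<gamma> \<and>
        (\<forall>x1 x2. (x1, x2) \<in> quadrant \<and> H \<theta>1 \<theta>2 (x1, x2) \<noteq> (x1, x2) \<longrightarrow>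
          (0 \<le> x1 \<and> x1 < 2 / \<theta>1 \<and> 0 \<le> x2 \<and> x2 < \<gamma> x1 \<longrightarrow>
            (\<lambda>m. (H \<theta>1 \<theta>2 ^^ m) (x1, x2)) \<longlonglongrightarrow> (0, 0)) \<and>
          (0 < x1 \<and> x1 < 2 / \<theta>1 \<and> x2 = \<gamma> x1 \<longrightarrow>
            (\<lambda>m. (H \<theta>1 \<theta>2 ^^ m) (x1, x2)) \<longlonglongrightarrow> Ebar \<theta>1 \<theta>2) \<and>
          (above_curve (2 / \<theta>1) \<gamma> (x1, x2) \<longrightarrow>
            filterlim (\<lambda>m. norm ((H \<theta>1 \<theta>2 ^^ m) (x1, x2))) at_top sequentially)))) \<and>
    (\<theta>1 > 2 * \<theta>2 \<longrightarrow>
      (\<exists>\<sigma>. invariant_curve (H \<theta>1 \<theta>2) (2 / \<theta>1) \<sigma> \<and>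
        E1 \<theta>1 \<in> curve (2 / \<theta>1) \<sigma> \<and> E2 \<theta>2 \<in> curve (2 / \<theta>1) \<sigma> \<and>
        (\<forall>x1 x2. (x1, x2) \<in> quadrant \<and> H \<theta>1 \<theta>2 (x1, x2) \<noteq> (x1, x2) \<longrightarrow>
          (0 \<le> x1 \<and> x1 < 2 / \<theta>1 \<and> 0 \<le> x2 \<and> x2 < \<sigma> x1 \<longrightarrow>
            (\<lambda>m. (H \<theta>1 \<theta>2 ^^ m) (x1, x2)) \<longlonglongrightarrow> (0, 0)) \<and>
          (0 < x1 \<and> x1 < 2 / \<theta>1 \<and> x2 = \<sigma> x1 \<longrightarrow>
            (\<lambda>m. (H \<theta>1 \<theta>2 ^^ m) (x1, x2)) \<longlonglongrightarrow> E1 \<theta>1) \<and>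
          (above_curve (2 / \<theta>1) \<sigma> (x1, x2) \<longrightarrow>
            filterlim (\<lambda>m. norm ((H \<theta>1 \<theta>2 ^^ m) (x1, x2))) at_top sequentially)))) \<and>
    (\<theta>2 > 2 * \<theta>1 \<longrightarrow>
      (\<exists>\<delta>. invariant_curve (H \<theta>1 \<theta>2) (2 / \<theta>1) \<delta> \<and>
        E1 \<theta>1 \<in> curve (2 / \<theta>1) \<delta> \<and> E2 \<theta>2 \<in> curve (2 / \<theta>1) \<delta> \<and>
        (\<forall>x1 x2. (x1, x2) \<in> quadrant \<and> H \<theta>1 \<theta>2 (x1, x2) \<noteq> (x1, x2) \<longrightarrow>
          (0 \<le> x1 \<and> x1 < 2 / \<theta>1 \<and> 0 \<le> x2 \<and> x2 < \<delta> x1 \<longrightarrow>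
            (\<lambda>m. (H \<theta>1 \<theta>2 ^^ m) (x1, x2)) \<longlonglongrightarrow> (0, 0)) \<and>
          (0 < x1 \<and> x1 < 2 / \<theta>1 \<and> x2 = \<delta> x1 \<longrightarrow>
            (\<lambda>m. (H \<theta>1 \<theta>2 ^^ m) (x1, x2)) \<longlonglongrightarrow> E2 \<theta>2) \<and>
          (above_curve (2 / \<theta>1) \<delta> (x1, x2) \<longrightarrow>
            filterlim (\<lambda>m. norm ((H \<theta>1 \<theta>2 ^^ m) (x1, x2))) at_top sequentially))))"
proof -
  \<comment> \<open>For these coefficients \<open>p < r\<close> reads
    \<open>\<theta>1 < 2 * \<theta>2\<close>, and \<open>s < q\<close> reads
    \<open>\<theta>2 < 2 * \<theta>1\<close>.\<close>
  interpret quadratic_map "\<theta>1 / 2" \<theta>1 \<theta>2 "\<theta>2 / 2"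
    using assms by unfold_locales auto
  have H: "H \<theta>1 \<theta>2 = F"
    by (auto simp: H_def F_def fun_eq_iff algebra_simps)
  have a: "2 / \<theta>1 = 1 / (\<theta>1 / 2)"
    by simp
  have E1: "E1 \<theta>1 = (1 / (\<theta>1 / 2), 0)" and E2: "E2 \<theta>2 = (0, 1 / (\<theta>2 / 2))"
    by (simp_all add: E1_def E2_def)
  show ?thesis
  proof (intro conjI impI)
    assume "\<theta>1 < 2 * \<theta>2 \<and> \<theta>2 < 2 * \<theta>1"
    then have \<theta>: "\<theta>1 / 2 < \<theta>2" "\<theta>2 / 2 < \<theta>1"
      by auto
    have fixed: "(x, y) = Ebar \<theta>1 \<theta>2"
      if "0 < x" "0 < y" and fp: "F (x, y) = (x, y)" for x y
    proof -
      \<comment> \<open>Positive coordinates cancel from the fixed point equations, which leaves a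
        linear system.\<close>
      have 1: "\<theta>1 * (x + 2 * y) = 2" and 2: "\<theta>2 * (y + 2 * x) = 2"
        using that by (simp_all add: F_def) (simp_all add: field_simps)
      \<comment> \<open>The combinations that eliminate \<open>y\<close> and \<open>x\<close>,
        respectively.\<close>
      have "3 * \<theta>1 * \<theta>2 * x = 2 * \<theta>1 * (\<theta>2 * (y + 2 * x)) - \<theta>2 * (\<theta>1 * (x + 2 * y))"
        and "3 * \<theta>1 * \<theta>2 * y = 2 * \<theta>2 * (\<theta>1 * (x + 2 * y)) - \<theta>1 * (\<theta>2 * (y + 2 * x))"
        by (simp_all add: algebra_simps)
      then have "3 * \<theta>1 * \<theta>2 * x = 4 * \<theta>1 - 2 * \<theta>2" "3 * \<theta>1 * \<theta>2 * y = 4 * \<theta>2 - 2 * \<theta>1"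
        unfolding 1 2 by simp_all
      then show ?thesis
        using assms by (simp add: Ebar_def eq_divide_eq mult.commute)
    qed
    have lim: "(\<lambda>n. (F ^^ n) z) \<longlonglongrightarrow> Ebar \<theta>1 \<theta>2" if "0 < fst z" "0 < snd z" "G z = 0" for z
      using tendsto_interior_fixed_point[OF \<theta> that] fixed by metis
    have "Ebar \<theta>1 \<theta>2 \<in> Q"
      using \<theta> assms by (auto simp: Ebar_def mem_Q_iff)
    moreover have "F (Ebar \<theta>1 \<theta>2) = Ebar \<theta>1 \<theta>2"
      using assms by (auto simp: Ebar_def F_def field_simps)
    ultimately have Ebar: "Ebar \<theta>1 \<theta>2 \<in> curve (1 / (\<theta>1 / 2)) g"
      by (rule fixed_point_in_curve)
    show "\<exists>\<gamma>. invariant_curve (H \<theta>1 \<theta>2) (2 / \<theta>1) \<gamma> \<and>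
        E1 \<theta>1 \<in> curve (2 / \<theta>1) \<gamma> \<and> E2 \<theta>2 \<in> curve (2 / \<theta>1) \<gamma> \<and> Ebar \<theta>1 \<theta>2 \<in> curve (2 / \<theta>1) \<gamma> \<and>
        (\<forall>x1 x2. (x1, x2) \<in> quadrant \<and> H \<theta>1 \<theta>2 (x1, x2) \<noteq> (x1, x2) \<longrightarrow>
          (0 \<le> x1 \<and> x1 < 2 / \<theta>1 \<and> 0 \<le> x2 \<and> x2 < \<gamma> x1 \<longrightarrow>
            (\<lambda>m. (H \<theta>1 \<theta>2 ^^ m) (x1, x2)) \<longlonglongrightarrow> (0, 0)) \<and>
          (0 < x1 \<and> x1 < 2 / \<theta>1 \<and> x2 = \<gamma> x1 \<longrightarrow>
            (\<lambda>m. (H \<theta>1 \<theta>2 ^^ m) (x1, x2)) \<longlonglongrightarrow> Ebar \<theta>1 \<theta>2) \<and>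
          (above_curve (2 / \<theta>1) \<gamma> (x1, x2) \<longrightarrow>
            filterlim (\<lambda>m. norm ((H \<theta>1 \<theta>2 ^^ m) (x1, x2))) at_top sequentially))"
      unfolding H a E1 E2
      by (intro exI[of _ g] conjI[OF invariant_curve_g] conjI[OF axis1_in_curve]
          conjI[OF axis2_in_curve] conjI[OF Ebar] allI impI
          orbit_trichotomy[OF lim])
  next
    assume "2 * \<theta>2 < \<theta>1"
    \<comment> \<open>The coefficients are ordered as \<open>s < r < p < q\<close>.\<close>
    then have \<theta>: "\<theta>2 < \<theta>1 / 2" "\<theta>2 / 2 < \<theta>1"
      using assms by auto
    show "\<exists>\<sigma>. invariant_curve (H \<theta>1 \<theta>2) (2 / \<theta>1) \<sigma> \<and>
        E1 \<theta>1 \<in> curve (2 / \<theta>1) \<sigma> \<and> E2 \<theta>2 \<in> curve (2 / \<theta>1) \<sigma> \<and>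
        (\<forall>x1 x2. (x1, x2) \<in> quadrant \<and> H \<theta>1 \<theta>2 (x1, x2) \<noteq> (x1, x2) \<longrightarrow>
          (0 \<le> x1 \<and> x1 < 2 / \<theta>1 \<and> 0 \<le> x2 \<and> x2 < \<sigma> x1 \<longrightarrow>
            (\<lambda>m. (H \<theta>1 \<theta>2 ^^ m) (x1, x2)) \<longlonglongrightarrow> (0, 0)) \<and>
          (0 < x1 \<and> x1 < 2 / \<theta>1 \<and> x2 = \<sigma> x1 \<longrightarrow>
            (\<lambda>m. (H \<theta>1 \<theta>2 ^^ m) (x1, x2)) \<longlonglongrightarrow> E1 \<theta>1) \<and>
          (above_curve (2 / \<theta>1) \<sigma> (x1, x2) \<longrightarrow>
            filterlim (\<lambda>m. norm ((H \<theta>1 \<theta>2 ^^ m) (x1, x2))) at_top sequentially))"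
      unfolding H a E1 E2
      by (intro exI[of _ g] conjI[OF invariant_curve_g] conjI[OF axis1_in_curve]
          conjI[OF axis2_in_curve] allI impI
          orbit_trichotomy[OF tendsto_axis1_fixed_point[OF \<theta>]])
  next
    assume "2 * \<theta>1 < \<theta>2"
    \<comment> \<open>The coefficients are ordered as \<open>p < q < s < r\<close>.\<close>
    then have \<theta>: "\<theta>1 / 2 < \<theta>2" "\<theta>1 < \<theta>2 / 2"
      using assms by auto
    show "\<exists>\<delta>. invariant_curve (H \<theta>1 \<theta>2) (2 / \<theta>1) \<delta> \<and>
        E1 \<theta>1 \<in> curve (2 / \<theta>1) \<delta> \<and> E2 \<theta>2 \<in> curve (2 / \<theta>1) \<delta> \<and>
        (\<forall>x1 x2. (x1, x2) \<in> quadrant \<and> H \<theta>1 \<theta>2 (x1, x2) \<noteq> (x1, x2) \<longrightarrow>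
          (0 \<le> x1 \<and> x1 < 2 / \<theta>1 \<and> 0 \<le> x2 \<and> x2 < \<delta> x1 \<longrightarrow>
            (\<lambda>m. (H \<theta>1 \<theta>2 ^^ m) (x1, x2)) \<longlonglongrightarrow> (0, 0)) \<and>
          (0 < x1 \<and> x1 < 2 / \<theta>1 \<and> x2 = \<delta> x1 \<longrightarrow>
            (\<lambda>m. (H \<theta>1 \<theta>2 ^^ m) (x1, x2)) \<longlonglongrightarrow> E2 \<theta>2) \<and>
          (above_curve (2 / \<theta>1) \<delta> (x1, x2) \<longrightarrow>
            filterlim (\<lambda>m. norm ((H \<theta>1 \<theta>2 ^^ m) (x1, x2))) at_top sequentially))"
      unfolding H a E1 E2
      by (intro exI[of _ g] conjI[OF invariant_curve_g] conjI[OF axis1_in_curve]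
          conjI[OF axis2_in_curve] allI impI
          orbit_trichotomy[OF tendsto_axis2_fixed_point[OF \<theta>]])
  qed
qed

end
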